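(* Let $k$ be a finite field, let $(W,B)$ be a non-degenerate symplectic space over $k$ of dimension $2m$, let $\{p_1,\dots,p_m,q_1,\dots,q_m\}$ be a symplectic basis of $(W,B)$, and let $A=M_m(k)$ with involution $a\mapsto a^*$ the transpose. For $a,b\in A$ let $L_{a,b}=\langle aP+bQ\rangle$ be as defined in the context. Then: (1) For $a,b\in A$, the subspace $L_{a,b}$ is Lagrangian if and only if $aA+bA=A$ and $ab^*=ba^*$. (2) Every Lagrangian subspace of $(W,B)$ is equal to $L_{a,b}$ for suitable $a,b\in A$. (3) If $L_{a,b}$ and $L_{a',b'}$ are Lagrangian ($a,b,a',b'\in A$), then $L_{a,b}=L_{a',b'}$ if and only if there is $c\in A$ with $a'=ca$ and $b'=cb$.
   Context: $B:W\times W\to k$ is a non-degenerate alternating bilinear form. A symplectic basis satisfies $B(p_i,q_j)=\delta_{ij}$ and $B(p_i,p_j)=B(q_i,q_j)=0$. A Lagrangian subspace is a maximal totally isotropic subspace (of dimension $m$). $M=W^m$ is a left $A$-module via $(hu)_i=\sum_j h_{ij}u_j$ for $h\in A$, $u=(u_1,\dots,u_m)\in M$. For $u\in M$, $\langle u\rangle$ denotes the subspace of $W$ spanned by $u_1,\dots,u_m$. Put $P=(p_1,\dots,p_m)$, $Q=(q_1,\dots,q_m)\in M$ and $L_{a,b}=\langle aP+bQ\rangle$. Here $aA+bA=\{ax+by: x,y\in A\}$. *)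

theory Defs
  imports "HOL-Analysis.Analysis"
begin

locale symplectic_space = vector_space smul
  for smul :: "'k::field \<Rightarrow> 'w::ab_group_add \<Rightarrow> 'w" +
  fixes B :: "'w \<Rightarrow> 'w \<Rightarrow> 'k"
  assumes linear_right: "\<And>x. Vector_Spaces.linear smul (*) (\<lambda>y. B x y)"
    and linear_left: "\<And>y. Vector_Spaces.linear smul (*) (\<lambda>x. B x y)"
    and alternating: "\<And>x. B x x = 0"
    and nondegenerate: "\<And>x. (\<forall>y. B x y = 0) \<Longrightarrow> x = 0"
begin

definition totally_isotropic :: "'w set \<Rightarrow> bool" where
  "totally_isotropic U \<longleftrightarrow> subspace U \<and> (\<forall>x\<in>U. \<forall>y\<in>U. B x y = 0)"

definition lagrangian :: "'w set \<Rightarrow> bool" where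
  "lagrangian U \<longleftrightarrow> totally_isotropic U \<and>
     (\<forall>V. totally_isotropic V \<longrightarrow> U \<subseteq> V \<longrightarrow> V = U)"

(* The families p and q need not be required to be injective and disjoint:
   this follows from the values of B. *)
definition symplectic_basis :: "'w ^ 'm \<Rightarrow> 'w ^ 'm \<Rightarrow> bool" where
  "symplectic_basis p q \<longleftrightarrow>
     independent (range (($) p) \<union> range (($) q)) \<and>
     span (range (($) p) \<union> range (($) q)) = UNIV \<and>
     (\<forall>i j. B (p $ i) (q $ j) = (if i = j then 1 else 0)) \<and>
     (\<forall>i j. B (p $ i) (p $ j) = 0) \<and>
     (\<forall>i j. B (q $ i) (q $ j) = 0)"

end

definition mat_act ::
  "('k::comm_ring_1 \<Rightarrow> 'w::ab_group_add \<Rightarrow> 'w) \<Rightarrow> 'k ^ 'm ^ 'm \<Rightarrow> 'w ^ 'm \<Rightarrow> 'w ^ 'm::finite" where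
  "mat_act smul h u = (\<chi> i. \<Sum>j\<in>UNIV. smul (h $ i $ j) (u $ j))"

definition comp_span :: "('k::comm_ring_1 \<Rightarrow> 'w::ab_group_add \<Rightarrow> 'w) \<Rightarrow> 'w ^ 'm \<Rightarrow> 'w set" where
  "comp_span smul u = module.span smul (range (($) u))"

definition L_space ::
  "('k::comm_ring_1 \<Rightarrow> 'w::ab_group_add \<Rightarrow> 'w) \<Rightarrow> 'w ^ 'm \<Rightarrow> 'w ^ 'm \<Rightarrow>
   'k ^ 'm ^ 'm \<Rightarrow> 'k ^ 'm ^ 'm::finite \<Rightarrow> 'w set" where
  "L_space smul P Q a b = comp_span smul (mat_act smul a P + mat_act smul b Q)"

definition right_ideal_sum :: "'k::semiring_1 ^ 'm ^ 'm \<Rightarrow> 'k ^ 'm ^ 'm::finite \<Rightarrow> ('k ^ 'm ^ 'm) set" where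
  "right_ideal_sum a b = {a ** x + b ** y | x y. True}"

end

theory Submission imports Defs begin

text \<open>
  Write \<open>u = aP + bQ\<close>. In the coordinates given by the symplectic basis,
  \<open>B(u\<^sub>i, u\<^sub>j)\<close> is the \<open>(i, j)\<close> entry of \<open>ab\<^sup>* - ba\<^sup>*\<close>, and the vector with coordinates
  \<open>(s, t)\<close> is orthogonal to all \<open>u\<^sub>i\<close> iff \<open>at - bs = 0\<close>. A Lagrangian subspace contains its
  orthogonal complement, so if \<open>L\<^sub>a\<^sub>,\<^sub>b\<close> is Lagrangian then the kernel of \<open>(s, t) \<mapsto> at - bs\<close> has at
  most \<open>|k|\<^sup>m\<close> elements. Hence this map is surjective, which is \<open>aA + bA = A\<close>. Conversely, a
  solution of \<open>ax + by = 1\<close> gives a family \<open>v\<close> with \<open>B(u\<^sub>i, v\<^sub>j) = \<delta>\<^sub>i\<^sub>j\<close>; then \<open>u\<close> and \<open>v\<close>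
  together form a basis of \<open>W\<close>, and a vector orthogonal to all \<open>u\<^sub>i\<close> is a combination of them.

  A Lagrangian subspace containing \<open>m\<close> independent vectors \<open>u\<^sub>i\<close> is spanned by them: their
  coefficient matrix has a right inverse, so their span is already Lagrangian, hence maximal.
\<close>

section \<open>Counting and one-sided matrix inverses\<close>

text \<open>Rank-nullity in counting form: \<open>inv f\<close> chooses one preimage per value, and
  \<open>x\<close> is determined by \<open>f x\<close> and its difference from the chosen preimage,
  which lies in the kernel.\<close>

lemma card_domain_le_card_range_times_kernel:
  fixes f :: "'a::{ab_group_add,finite} \<Rightarrow> 'b::ab_group_add"
  assumes "\<And>x y. f (x - y) = f x - f y"
  shows "CARD('a) \<le> card (range f) * card {x. f x = 0}"
proof -
  define g where "g = (\<lambda>x. (f x, x - inv f (f x)))"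
  have "inj g"
  proof (rule injI)
    fix x y assume "g x = g y"
    then have "f x = f y" and "x - inv f (f x) = y - inv f (f y)"
      unfolding g_def by blast+
    then show "x = y"
      by (metis diff_add_cancel)
  qed
  moreover have "range g \<subseteq> range f \<times> {x. f x = 0}"
    by (auto simp: g_def assms f_inv_into_f)
  ultimately have "CARD('a) \<le> card (range f \<times> {x. f x = 0})"
    by (intro card_inj_on_le[of g]) auto
  then show ?thesis
    by (simp add: card_cartesian_product)
qed

lemma matrix_add_rdistrib: "(A + B) ** C = A ** C + B ** C"
  by (simp add: vec_eq_iff matrix_matrix_mult_def distrib_right sum.distrib)

lemma right_ideal_sum_eq_UNIV_iff:
  "right_ideal_sum a b = UNIV \<longleftrightarrow> (\<exists>x y. a ** x + b ** y = mat 1)"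
proof
  assume "right_ideal_sum a b = UNIV"
  then have "mat 1 \<in> right_ideal_sum a b"
    by simp
  then show "\<exists>x y. a ** x + b ** y = mat 1"
    unfolding right_ideal_sum_def by force
next
  assume "\<exists>x y. a ** x + b ** y = mat 1"
  then obtain x y where "a ** x + b ** y = mat 1"
    by blast
  then have "a ** (x ** c) + b ** (y ** c) = c" for c
    by (simp add: matrix_mul_assoc flip: matrix_add_rdistrib)
  then have "c \<in> right_ideal_sum a b" for c
    unfolding right_ideal_sum_def by (metis (mono_tags, lifting) mem_Collect_eq)
  then show "right_ideal_sum a b = UNIV"
    by blast
qed

lemma sum_UNIV_Plus:
  "(\<Sum>r\<in>(UNIV :: ('a::finite + 'b::finite) set). f r)
    = (\<Sum>i\<in>UNIV. f (Inl i)) + (\<Sum>j\<in>UNIV. f (Inr j))"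
  unfolding UNIV_Plus_UNIV[symmetric] by (subst sum.Plus) (auto simp: comp_def)

text \<open>The hypothesis says that the rows of the block matrix \<open>[a b]\<close> are linearly
  independent; over a field such a matrix has a right inverse, whose two blocks are \<open>x\<close>
  and \<open>y\<close>.\<close>

lemma right_ideal_sum_eq_UNIV_if_trivial_left_kernel:
  fixes a b :: "'k::field ^ 'm ^ 'm::finite"
  assumes "\<And>c. c v* a = 0 \<Longrightarrow> c v* b = 0 \<Longrightarrow> c = 0"
  shows "right_ideal_sum a b = UNIV"
proof -
  \<comment> \<open>\<open>M\<close> is the transpose of \<open>[a b]\<close>, so that a right
    inverse of \<open>[a b]\<close> becomes a left inverse of \<open>M\<close>, which exists as soon
    as the kernel is trivial.\<close>
  define M :: "'k ^ 'm ^ ('m + 'm)" where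
    "M = (\<chi> r. \<chi> i. case r of Inl j \<Rightarrow> a $ i $ j | Inr j \<Rightarrow> b $ i $ j)"
  have M: "(M *v c) $ Inl j = (c v* a) $ j" "(M *v c) $ Inr j = (c v* b) $ j" for c j
    unfolding matrix_vector_mult_def vector_matrix_mult_def
    by (simp_all add: M_def mult.commute[of "c $ _"])
  have "c = 0" if "M *v c = 0" for c
  proof (rule assms)
    have "(M *v c) $ r = 0" for r
      by (simp only: that zero_index)
    then show "c v* a = 0" "c v* b = 0"
      by (simp_all only: vec_eq_iff zero_index flip: M) simp_all
  qed
  then have "\<exists>N :: 'k ^ ('m + 'm) ^ 'm. N ** M = mat 1"
    unfolding matrix_left_invertible_ker by simp
  then obtain N :: "'k ^ ('m + 'm) ^ 'm" where N: "N ** M = mat 1" ..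
  define x :: "'k ^ 'm ^ 'm" where "x = (\<chi> j i. N $ i $ Inl j)"
  define y :: "'k ^ 'm ^ 'm" where "y = (\<chi> j i. N $ i $ Inr j)"
  have "(a ** x + b ** y) $ i $ j = (N ** M) $ j $ i" for i j
    unfolding matrix_matrix_mult_def
    by (simp add: sum_UNIV_Plus) (simp add: M_def x_def y_def mult.commute[of "N $ _ $ _"])
  then have "a ** x + b ** y = mat 1"
    unfolding N by (simp add: vec_eq_iff mat_def eq_commute)
  then show ?thesis
    unfolding right_ideal_sum_eq_UNIV_iff by blast
qed

section \<open>Linear combinations of finite families\<close>

text \<open>
  A separate locale, because facts added to \<^locale>\<open>vector_space\<close> itself would be shadowed by their
  instances for real vector spaces.
\<close>

locale vector_families = vector_space
begin

definition lincomb :: "'a ^ 'm \<Rightarrow> 'b ^ 'm::finite \<Rightarrow> 'b" where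
  "lincomb c u = (\<Sum>i\<in>UNIV. scale (c $ i) (u $ i))"

lemma lincomb_axis: "lincomb (axis i 1) u = u $ i"
proof -
  have "lincomb (axis i 1) u = (\<Sum>j\<in>UNIV. if j = i then u $ j else 0)"
    unfolding lincomb_def by (rule sum.cong) (auto simp: axis_def)
  then show ?thesis
    by simp
qed

lemma lincomb_add_left: "lincomb (c + d) u = lincomb c u + lincomb d u"
  by (simp add: lincomb_def scale_left_distrib sum.distrib)

lemma lincomb_add_right: "lincomb c (u + v) = lincomb c u + lincomb c v"
  by (simp add: lincomb_def scale_right_distrib sum.distrib)

lemma lincomb_scale:
  fixes c :: "'a ^ 'm::finite"
  shows "lincomb (\<chi> i. k * c $ i) u = scale k (lincomb c u)"
  by (simp add: lincomb_def scale_sum_right)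

lemma lincomb_zero: "lincomb 0 u = 0"
  by (simp add: lincomb_def)

lemma mat_act_nth: "mat_act scale h u $ i = lincomb (h $ i) u"
  by (simp add: mat_act_def lincomb_def)

text \<open>Associativity \<open>c (h u) = (c h) u\<close>, with \<open>c\<close> read as a row
  vector.\<close>

lemma lincomb_mat_act: "lincomb c (mat_act scale h u) = lincomb (c v* h) u"
proof -
  have "lincomb c (mat_act scale h u)
      = (\<Sum>i\<in>UNIV. \<Sum>j\<in>UNIV. scale (c $ i * h $ i $ j) (u $ j))"
    by (simp add: lincomb_def mat_act_def scale_sum_right)
  also have "\<dots> = lincomb (c v* h) u"
    by (subst sum.swap) (simp add: lincomb_def vector_matrix_mult_def scale_sum_left mult.commute)
  finally show ?thesis .
qed

lemma subspace_range_lincomb: "subspace (range (\<lambda>c. lincomb c u))"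
  unfolding subspace_def
  by (auto simp: image_iff) (metis lincomb_zero, metis lincomb_add_left, metis lincomb_scale)

lemma comp_span_eq_range_lincomb: "comp_span scale u = range (\<lambda>c. lincomb c u)"
proof -
  have "span (range (($) u)) = range (\<lambda>c. lincomb c u)"
  proof (rule span_unique)
    show "range (($) u) \<subseteq> range (\<lambda>c. lincomb c u)"
      by (metis (no_types, lifting) image_subsetI lincomb_axis rangeI)
    show "range (\<lambda>c. lincomb c u) \<subseteq> T" if "range (($) u) \<subseteq> T" "subspace T" for T
      using that unfolding lincomb_def by (auto intro!: subspace_sum subspace_scale)
  qed (rule subspace_range_lincomb)
  then show ?thesis
    by (simp add: comp_span_def)
qed

text \<open>\<open>independent\<close> speaks of the set of entries and cannot see repetitions;
  injectivity makes it a statement about the family.\<close>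

lemma lincomb_eq_0_independent:
  assumes ind: "independent (range (($) u))" and inj: "inj (($) u)" and "lincomb c u = 0"
  shows "c = 0"
proof -
  have "(\<Sum>v\<in>range (($) u). scale (c $ inv (($) u) v) v) = (\<Sum>i\<in>UNIV. scale (c $ i) (u $ i))"
    by (subst sum.reindex[OF inj]) (simp only: comp_def inv_f_f[OF inj])
  then have *: "(\<Sum>v\<in>range (($) u). scale (c $ inv (($) u) v) v) = 0"
    using assms(3) by (simp only: lincomb_def)
  have "c $ inv (($) u) (u $ i) = 0" for i
    by (rule independentD[OF ind _ subset_refl *]) simp_all
  then have "c $ i = 0" for i
    by (simp only: inv_f_f[OF inj])
  then show ?thesis
    by (simp add: vec_eq_iff)
qed

text \<open>This dichotomy makes it possible to treat a Lagrangian subspace without first computing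
  its dimension: a basis of \<open>U\<close> either fits into \<open>m\<close> places or has
  \<open>m\<close> independent vectors to offer.\<close>

lemma obtain_family_spanning_or_independent:
  assumes "subspace U" "finite U"
  obtains u :: "'b ^ 'm::finite"
  where "comp_span scale u = U"
  | u :: "'b ^ 'm::finite"
  where "comp_span scale u \<subseteq> U" "\<And>c. lincomb c u = 0 \<Longrightarrow> c = 0"
proof -
  obtain E where E: "E \<subseteq> U" "independent E" "U \<subseteq> span E"
    by (rule maximal_independent_subset)
  have UE: "span E = U"
    using span_minimal[OF E(1) assms(1)] E(3) by (rule subset_antisym)
  have "finite E"
    using E(1) assms(2) by (rule finite_subset)
  show ?thesis
  proof (cases "card E \<le> CARD('m)")
    case True
    then obtain g :: "'b \<Rightarrow> 'm" where g: "inj_on g E"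
      using card_le_inj[OF \<open>finite E\<close> finite_class.finite_UNIV] by blast
    \<comment> \<open>Places not taken by a basis vector are padded with 0, which changes no
      span.\<close>
    define u :: "'b ^ 'm" where "u = (\<chi> i. if i \<in> g ` E then inv_into E g i else 0)"
    have "e = u $ g e" if "e \<in> E" for e
      using g that by (simp add: u_def)
    then have "E \<subseteq> range (($) u)"
      by blast
    moreover have "range (($) u) \<subseteq> U"
      using E(1) subspace_0[OF assms(1)] by (auto simp: u_def inv_into_into)
    ultimately have "span (range (($) u)) = U"
      using span_mono[of E "range (($) u)"] span_minimal[OF _ assms(1), of "range (($) u)"] UE
      by simp
    then show ?thesis
      by (intro that(1)) (simp add: comp_span_def)
  next
    case False
    then obtain g :: "'m \<Rightarrow> 'b" where g: "g ` UNIV \<subseteq> E" "inj g"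
      using card_le_inj[of "UNIV :: 'm set" E, OF _ \<open>finite E\<close>] by (auto simp del: image_subset_iff)
    define u :: "'b ^ 'm" where "u = (\<chi> i. g i)"
    have u: "($) u = g"
      by (rule ext) (simp add: u_def)
    have "comp_span scale u \<subseteq> U"
      using span_mono[OF g(1)] by (simp add: comp_span_def u UE)
    moreover have "independent (range (($) u))" "inj (($) u)"
      using g independent_mono[OF E(2)] by (simp_all add: u)
    then have "c = 0" if "lincomb c u = 0" for c
      using that by (rule lincomb_eq_0_independent)
    ultimately show ?thesis
      by (rule that(2))
  qed
qed

end

sublocale symplectic_space \<subseteq> vector_families smul ..

section \<open>The alternating form and Lagrangian subspaces\<close>

context symplectic_space
begin

lemma B_add_left: "B (x + y) z = B x z + B y z"
  and B_add_right: "B z (x + y) = B z x + B z y"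
  and B_scale_left: "B (smul k x) z = k * B x z"
  and B_scale_right: "B z (smul k x) = k * B z x"
  using linear_left[of z] linear_right[of z] by (simp_all add: Vector_Spaces.linear_iff)

lemma B_zero_left: "B 0 z = 0"
  using B_scale_left[of 0 0 z] by simp

lemma B_zero_right: "B z 0 = 0"
  using B_scale_right[of z 0 0] by simp

lemma B_swap: "B y x = - B x y"
proof -
  have "B y x + B x y = B (x + y) (x + y)"
    by (simp add: B_add_left B_add_right alternating[of x] alternating[of y])
  then show ?thesis
    by (simp only: alternating eq_neg_iff_add_eq_0)
qed

lemma B_sum_left: "B (sum f I) z = (\<Sum>i\<in>I. B (f i) z)"
  by (induction I rule: infinite_finite_induct) (auto simp: B_zero_left B_add_left)

lemma B_sum_right: "B z (sum f I) = (\<Sum>i\<in>I. B z (f i))"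
  by (induction I rule: infinite_finite_induct) (auto simp: B_zero_right B_add_right)

lemma B_lincomb_left: "B (lincomb c u) z = (\<Sum>i\<in>UNIV. c $ i * B (u $ i) z)"
  by (simp add: lincomb_def B_sum_left B_scale_left)

lemma B_lincomb_right: "B z (lincomb c u) = (\<Sum>i\<in>UNIV. c $ i * B z (u $ i))"
  by (simp add: lincomb_def B_sum_right B_scale_right)

lemma totally_isotropic_comp_span_iff:
  "totally_isotropic (comp_span smul u) \<longleftrightarrow> (\<forall>i j. B (u $ i) (u $ j) = 0)"
proof
  assume "totally_isotropic (comp_span smul u)"
  then show "\<forall>i j. B (u $ i) (u $ j) = 0"
    unfolding totally_isotropic_def comp_span_def using span_base by blast
next
  assume "\<forall>i j. B (u $ i) (u $ j) = 0"
  then show "totally_isotropic (comp_span smul u)"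
    unfolding totally_isotropic_def comp_span_eq_range_lincomb
    using subspace_range_lincomb by (auto simp: B_lincomb_left B_lincomb_right)
qed

lemma orthogonal_comp_span_iff:
  "(\<forall>z\<in>comp_span smul u. B z w = 0) \<longleftrightarrow> (\<forall>i. B (u $ i) w = 0)"
proof
  show "\<forall>i. B (u $ i) w = 0" if "\<forall>z\<in>comp_span smul u. B z w = 0"
    using that unfolding comp_span_def using span_base by blast
  show "\<forall>z\<in>comp_span smul u. B z w = 0" if "\<forall>i. B (u $ i) w = 0"
    using that unfolding comp_span_eq_range_lincomb by (auto simp: B_lincomb_left)
qed

text \<open>If \<open>w\<close> is orthogonal to \<open>U\<close>, then adjoining \<open>w\<close>
  keeps \<open>U\<close> totally isotropic because \<open>B w w = 0\<close>, so maximality puts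
  \<open>w\<close> into \<open>U\<close>. Conversely, every vector of a totally isotropic space
  containing \<open>U\<close> is orthogonal to \<open>U\<close>.\<close>

lemma lagrangian_iff:
  "lagrangian U \<longleftrightarrow> totally_isotropic U \<and> (\<forall>w. (\<forall>u\<in>U. B u w = 0) \<longrightarrow> w \<in> U)"
proof (intro iffI conjI allI impI)
  assume L: "lagrangian U"
  then show iso: "totally_isotropic U"
    by (simp add: lagrangian_def)
  fix w assume w: "\<forall>u\<in>U. B u w = 0"
  have U: "span U = U" "\<And>x y. x \<in> U \<Longrightarrow> y \<in> U \<Longrightarrow> B x y = 0"
    using iso by (auto simp: totally_isotropic_def span_eq_iff)
  have "B x y = 0" if "x \<in> span (insert w U)" "y \<in> span (insert w U)" for x y
  proof -
    obtain k l where kl: "x - smul k w \<in> U" "y - smul l w \<in> U"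
      using \<open>x \<in> _\<close> \<open>y \<in> _\<close> U(1) by (auto simp: span_breakdown_eq)
    define x' y' where "x' = x - smul k w" and "y' = y - smul l w"
    have "x = x' + smul k w" "y = y' + smul l w" "x' \<in> U" "y' \<in> U"
      using kl by (auto simp: x'_def y'_def)
    moreover have "B w y' = 0"
      using w \<open>y' \<in> U\<close> B_swap[of w y'] by simp
    ultimately show ?thesis
      using w U(2) by (simp add: B_add_left B_add_right B_scale_left B_scale_right alternating)
  qed
  then have "totally_isotropic (span (insert w U))"
    by (simp add: totally_isotropic_def)
  then have "span (insert w U) = U"
    using L span_superset[of "insert w U"] unfolding lagrangian_def by blast
  then show "w \<in> U"
    using span_base[of w "insert w U"] by simp
next
  assume "totally_isotropic U \<and> (\<forall>w. (\<forall>u\<in>U. B u w = 0) \<longrightarrow> w \<in> U)"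
  then show "lagrangian U"
    unfolding lagrangian_def totally_isotropic_def by blast
qed

end

section \<open>Coordinates in a symplectic basis\<close>

locale finite_symplectic_basis = symplectic_space smul B
  for smul :: "'k::{field,finite} \<Rightarrow> 'w::ab_group_add \<Rightarrow> 'w" and B +
  fixes p q :: "'w ^ 'm::finite"
  assumes basis: "symplectic_basis p q"
begin

definition comb :: "'k ^ 'm \<Rightarrow> 'k ^ 'm \<Rightarrow> 'w" where
  "comb s t = lincomb s p + lincomb t q"

lemma B_basis:
  "B (p $ i) (q $ j) = (if i = j then 1 else 0)" "B (q $ j) (p $ i) = (if i = j then - 1 else 0)"
  "B (p $ i) (p $ j) = 0" "B (q $ i) (q $ j) = 0"
  using basis B_swap[of "q $ j" "p $ i"] by (auto simp: symplectic_basis_def)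

lemma B_p_comb: "B (p $ i) (comb s t) = t $ i"
  and B_comb_q: "B (comb s t) (q $ i) = s $ i"
  and B_q_comb: "B (q $ i) (comb s t) = - s $ i"
  by (simp_all add: comb_def B_add_left B_add_right B_lincomb_left B_lincomb_right B_basis
      if_distrib[of "\<lambda>x. _ * x"] cong: if_cong)

lemma B_comb_comb: "B (comb s t) (comb s' t') = (\<Sum>i\<in>UNIV. s $ i * t' $ i - t $ i * s' $ i)"
  by (subst comb_def)
    (simp add: B_add_left B_lincomb_left B_p_comb B_q_comb sum_subtractf sum_negf)

text \<open>Pairing with \<open>q\<close> and \<open>p\<close> recovers the coordinates
  \<open>s\<close> and \<open>t\<close>.\<close>

lemma comb_inject: "comb s t = comb s' t' \<longleftrightarrow> s = s' \<and> t = t'"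
  by (metis B_comb_q B_p_comb vec_eq_iff)

lemma comb_surj: "\<exists>s t. w = comb s t"
proof -
  let ?R = "{comb s t |s t. True}"
  have "subspace ?R"
    unfolding subspace_def
  proof (intro conjI ballI allI)
    have "comb 0 0 = 0"
      by (simp add: comb_def lincomb_zero)
    then show "0 \<in> ?R"
      by (metis (mono_tags, lifting) mem_Collect_eq)
    show "x + y \<in> ?R" if x: "x \<in> ?R" and y: "y \<in> ?R" for x y
    proof -
      obtain s t s' t' where "x = comb s t" "y = comb s' t'"
        using x y by blast
      then have "x + y = comb (s + s') (t + t')"
        by (simp add: comb_def lincomb_add_left)
      then show ?thesis
        by blast
    qed
    show "smul k x \<in> ?R" if x: "x \<in> ?R" for k x
    proof -
      obtain s t where "x = comb s t"
        using x by blast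
      then have "smul k x = comb (\<chi> i. k * s $ i) (\<chi> i. k * t $ i)"
        by (simp add: comb_def lincomb_scale scale_right_distrib)
      then show ?thesis
        by blast
    qed
  qed
  moreover have "p $ i = comb (axis i 1) 0" "q $ i = comb 0 (axis i 1)" for i
    by (simp_all add: comb_def lincomb_axis lincomb_zero)
  then have "range (($) p) \<union> range (($) q) \<subseteq> ?R"
    by blast
  ultimately have "span (range (($) p) \<union> range (($) q)) \<subseteq> ?R"
    by (rule span_minimal[rotated])
  then show ?thesis
    using basis by (auto simp: symplectic_basis_def)
qed

lemma bij_comb: "bij (\<lambda>(s, t). comb s t)"
  using comb_surj by (auto simp: bij_def inj_def comb_inject surj_def)

text \<open>Since \<open>W\<close> is in bijection with pairs of vectors over a finite field,
  dimension arguments can be replaced by counting.\<close>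

lemma finite_W: "finite (UNIV :: 'w set)"
  using bij_betw_finite[OF bij_comb] by simp

text \<open>Pairings with \<open>u\<close> and \<open>v\<close> recover all coefficients of a
  combination of the two families, so by counting these combinations fill \<open>W\<close>;
  orthogonality to \<open>u\<close> then kills the coefficients at \<open>v\<close>.\<close>

lemma in_comp_span_if_dual:
  assumes iso: "\<And>i j. B (u $ i) (u $ j) = 0"
    and dual: "\<And>i j. B (u $ i) (v $ j) = (if i = j then 1 else 0)"
    and w: "\<And>i. B (u $ i) w = 0"
  shows "w \<in> comp_span smul (u :: 'w ^ 'm)"
proof -
  define G where "G = (\<lambda>(c, d). lincomb c u + lincomb d v)"
  have Bu: "B (u $ j) (G (c, d)) = d $ j" for j c d
    by (simp add: G_def B_add_right B_lincomb_right iso dual if_distrib[of "\<lambda>x. _ * x"] cong: if_cong)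
  \<comment> \<open>Entries of \<open>v\<close> may pair nontrivially with each other, so a term in
    \<open>d\<close> remains; it cancels once \<open>d = d'\<close> is known.\<close>
  have Bv: "B (G (c, d)) (v $ j) = c $ j + B (lincomb d v) (v $ j)" for j c d
    by (simp add: G_def B_add_left B_lincomb_left[of c] dual if_distrib[of "\<lambda>x. _ * x"] cong: if_cong)
  have "inj G"
  proof (rule injI, clarify)
    fix c d c' d' assume eq: "G (c, d) = G (c', d')"
    then have "d = d'"
      by (metis Bu vec_eq_iff)
    moreover have "c = c'"
      using eq Bv[of c d] Bv[of c' d'] \<open>d = d'\<close> by (simp add: vec_eq_iff)
    ultimately show "c = c' \<and> d = d'"
      by simp
  qed
  \<comment> \<open>The domain of \<open>G\<close> is also the coordinate space of \<open>W\<close>,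
    so the injective \<open>G\<close> is onto.\<close>
  then have "card (range G) = card (UNIV :: 'w set)"
    using bij_betw_same_card[OF bij_comb] by (simp add: card_image)
  then have "range G = UNIV"
    using finite_W by (simp add: card_subset_eq)
  then obtain c d where cd: "w = G (c, d)"
    by (metis surj_pair surj_def)
  with w have "d = 0"
    by (simp add: Bu vec_eq_iff)
  then have "w = lincomb c u"
    by (simp add: cd G_def lincomb_zero)
  then show ?thesis
    by (simp add: comp_span_eq_range_lincomb)
qed

section \<open>The generators of \<open>L a b\<close>\<close>

definition gens :: "'k ^ 'm ^ 'm \<Rightarrow> 'k ^ 'm ^ 'm \<Rightarrow> 'w ^ 'm" where
  "gens a b = mat_act smul a p + mat_act smul b q"

abbreviation L :: "'k ^ 'm ^ 'm \<Rightarrow> 'k ^ 'm ^ 'm \<Rightarrow> 'w set" where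
  "L \<equiv> L_space smul p q"

lemma gens_nth: "gens a b $ i = comb (a $ i) (b $ i)"
  by (simp add: gens_def comb_def mat_act_nth)

lemma lincomb_gens: "lincomb c (gens a b) = comb (c v* a) (c v* b)"
  by (simp add: gens_def lincomb_add_right lincomb_mat_act comb_def)

lemma L_gens: "L a b = comp_span smul (gens a b)"
  by (simp add: L_space_def gens_def)

lemma L_eq: "L a b = range (\<lambda>c. comb (c v* a) (c v* b))"
  by (simp add: L_gens comp_span_eq_range_lincomb lincomb_gens)

lemma gens_surj: "\<exists>a b. u = gens a b"
proof -
  have "\<forall>i. \<exists>st. u $ i = comb (fst st) (snd st)"
    using comb_surj by simp
  then obtain st where "\<And>i. u $ i = comb (fst (st i)) (snd (st i))"
    by metis
  then have "u = gens (\<chi> i. fst (st i)) (\<chi> i. snd (st i))"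
    by (simp add: vec_eq_iff gens_nth)
  then show ?thesis
    by blast
qed

lemma B_gens_comb: "B (gens a b $ i) (comb s t) = (a *v t - b *v s) $ i"
  by (simp add: gens_nth B_comb_comb matrix_vector_mult_def sum_subtractf)

lemma isotropic_gens_iff:
  "(\<forall>i j. B (gens a b $ i) (gens a b $ j) = 0) \<longleftrightarrow> a ** transpose b = b ** transpose a"
  by (simp add: gens_nth B_comb_comb vec_eq_iff matrix_matrix_mult_def transpose_def sum_subtractf)

lemma totally_isotropic_L_iff: "totally_isotropic (L a b) \<longleftrightarrow> a ** transpose b = b ** transpose a"
  unfolding L_gens totally_isotropic_comp_span_iff isotropic_gens_iff ..

section \<open>When \<open>L a b\<close> is Lagrangian\<close>

lemma right_ideal_sum_if_lagrangian:
  assumes "lagrangian (L a b)"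
  shows "right_ideal_sum a b = UNIV"
proof -
  define f where "f = (\<lambda>(s, t). a *v t - b *v s)"
  have "x \<in> range (\<lambda>c. (c v* a, c v* b))" if "f x = 0" for x
  proof -
    obtain s t where x: "x = (s, t)"
      by (cases x)
    have "B (gens a b $ i) (comb s t) = 0" for i
      using that by (simp add: B_gens_comb f_def x)
    then have "comb s t \<in> L a b"
      using assms orthogonal_comp_span_iff[of "gens a b" "comb s t"]
      unfolding lagrangian_iff L_gens by blast
    then show ?thesis
      by (auto simp: L_eq comb_inject x)
  qed
  \<comment> \<open>In coordinates the kernel of \<open>f\<close> is the orthogonal complement of
    \<open>L a b\<close>; it is covered by the coefficient vectors \<open>c\<close>, which bounds
    its size.\<close>
  then have "{x. f x = 0} \<subseteq> range (\<lambda>c. (c v* a, c v* b))"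
    by blast
  then have ker: "card {x. f x = 0} \<le> CARD('k ^ 'm)"
    by (meson card_image_le card_mono finite order_trans)
  have "CARD('k ^ 'm) * CARD('k ^ 'm) = CARD(('k ^ 'm) \<times> ('k ^ 'm))"
    by (simp only: card_prod)
  also have "\<dots> \<le> card (range f) * card {x. f x = 0}"
    by (rule card_domain_le_card_range_times_kernel)
      (auto simp: f_def matrix_vector_mult_diff_distrib)
  also have "\<dots> \<le> card (range f) * CARD('k ^ 'm)"
    using ker by simp
  finally have "CARD('k ^ 'm) \<le> card (range f)"
    by simp
  then have "range f = UNIV"
    by (intro card_seteq) auto
  \<comment> \<open>Preimages of the unit vectors supply the columns of \<open>x\<close> and, up to
    sign, of \<open>y\<close>.\<close>
  then have "\<exists>s t. axis j 1 = a *v t - b *v s" for j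
    unfolding f_def surj_def by (metis case_prod_conv surj_pair)
  then obtain s t where st: "\<And>j. axis j 1 = a *v t j - b *v s j"
    by metis
  define x :: "'k ^ 'm ^ 'm" where "x = (\<chi> i j. t j $ i)"
  define y :: "'k ^ 'm ^ 'm" where "y = (\<chi> i j. - s j $ i)"
  have "(a ** x + b ** y) $ i $ j = axis j 1 $ i" for i j
    unfolding st
    by (simp add: x_def y_def matrix_matrix_mult_def matrix_vector_mult_def sum_negf)
  then have "a ** x + b ** y = mat 1"
    by (simp add: vec_eq_iff mat_def axis_def)
  then show ?thesis
    unfolding right_ideal_sum_eq_UNIV_iff by blast
qed

lemma lagrangian_if_right_ideal_sum:
  assumes "right_ideal_sum a b = UNIV" and sym: "a ** transpose b = b ** transpose a"
  shows "lagrangian (L a b)"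
  unfolding lagrangian_iff
proof (intro conjI allI impI)
  show "totally_isotropic (L a b)"
    using sym by (simp add: totally_isotropic_L_iff)
  obtain x y where xy: "a ** x + b ** y = mat 1"
    using assms(1) unfolding right_ideal_sum_eq_UNIV_iff by blast
  \<comment> \<open>The pairing with the vector of coordinates \<open>(s, t)\<close> is
    \<open>a *v t - b *v s\<close>; taking the columns of \<open>x\<close> for \<open>t\<close> and
    those of \<open>- y\<close> for \<open>s\<close> turns it into
    \<open>a ** x + b ** y\<close>.\<close>
  define v where "v = gens (- transpose y) (transpose x)"
  have dual: "B (gens a b $ i) (v $ j) = (if i = j then 1 else 0)" for i j
  proof -
    have "B (gens a b $ i) (v $ j) = (a ** x + b ** y) $ i $ j"
      by (simp add: v_def gens_nth B_comb_comb matrix_matrix_mult_def transpose_def sum.distrib)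
    then show ?thesis
      by (simp add: xy mat_def)
  qed
  have iso: "B (gens a b $ i) (gens a b $ j) = 0" for i j
    using sym isotropic_gens_iff by blast
  fix w assume "\<forall>u\<in>L a b. B u w = 0"
  then have "B (gens a b $ i) w = 0" for i
    unfolding L_gens orthogonal_comp_span_iff by blast
  then show "w \<in> L a b"
    unfolding L_gens using iso dual by (intro in_comp_span_if_dual[of "gens a b" v])
qed

lemma lagrangian_L_iff:
  "lagrangian (L a b) \<longleftrightarrow> right_ideal_sum a b = UNIV \<and> a ** transpose b = b ** transpose a"
proof
  assume lag: "lagrangian (L a b)"
  then have "totally_isotropic (L a b)"
    by (simp add: lagrangian_def)
  with lag show "right_ideal_sum a b = UNIV \<and> a ** transpose b = b ** transpose a"
    by (simp add: right_ideal_sum_if_lagrangian totally_isotropic_L_iff)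
qed (simp add: lagrangian_if_right_ideal_sum)

section \<open>Representing and comparing Lagrangian subspaces\<close>

lemma lagrangian_eq_L:
  assumes U: "lagrangian U"
  shows "\<exists>a b. U = L a b"
proof -
  have iso: "totally_isotropic U" and sub: "subspace U"
    using U by (auto simp: lagrangian_def totally_isotropic_def)
  have "finite U"
    by (rule finite_subset[OF subset_UNIV finite_W])
  from sub this show ?thesis
  proof (cases rule: obtain_family_spanning_or_independent[where 'm = 'm])
    case (1 u)
    moreover obtain a b where "u = gens a b"
      using gens_surj by blast
    ultimately have "U = L a b"
      by (simp add: L_gens)
    then show ?thesis
      by blast
  next
    case (2 u)
    obtain a b where u: "u = gens a b"
      using gens_surj by blast
    have L: "L a b \<subseteq> U"
      using 2(1) by (simp add: L_gens u)
    have "totally_isotropic (L a b)"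
      using iso L subspace_span unfolding totally_isotropic_def L_gens comp_span_def by (meson subsetD)
    \<comment> \<open>Independence of the entries of \<open>u\<close> is exactly a trivial common
      left kernel of \<open>a\<close> and \<open>b\<close>.\<close>
    moreover have "right_ideal_sum a b = UNIV"
    proof (rule right_ideal_sum_eq_UNIV_if_trivial_left_kernel)
      fix c assume "c v* a = 0" "c v* b = 0"
      then have "lincomb c u = 0"
        by (simp add: u lincomb_gens comb_def lincomb_zero)
      then show "c = 0"
        by (rule 2(2))
    qed
    ultimately have "lagrangian (L a b)"
      by (simp add: lagrangian_L_iff totally_isotropic_L_iff)
    then have "U = L a b"
      using L iso by (simp add: lagrangian_def)
    then show ?thesis
      by blast
  qed
qed

text \<open>Each generator of \<open>L a' b'\<close> is a combination of those of
  \<open>L a b\<close>; uniqueness of coordinates makes one coefficient row serve both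
  \<open>a\<close> and \<open>b\<close>, and these rows form \<open>c\<close>.\<close>

lemma L_subset_iff: "L a' b' \<subseteq> L a b \<longleftrightarrow> (\<exists>c. a' = c ** a \<and> b' = c ** b)"
proof
  assume sub: "L a' b' \<subseteq> L a b"
  have "gens a' b' $ i \<in> L a' b'" for i
    unfolding L_gens comp_span_def by (simp add: span_base)
  then have "\<exists>c. comb (a' $ i) (b' $ i) = comb (c v* a) (c v* b)" for i
    using sub unfolding gens_nth L_eq[of a b] by blast
  then obtain c where c: "\<And>i. a' $ i = c i v* a" "\<And>i. b' $ i = c i v* b"
    unfolding comb_inject by metis
  have "a' = (\<chi> i. c i) ** a" "b' = (\<chi> i. c i) ** b"
    by (simp_all add: vec_eq_iff c matrix_matrix_mult_def vector_matrix_mult_def mult.commute)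
  then show "\<exists>c. a' = c ** a \<and> b' = c ** b"
    by blast
next
  assume "\<exists>c. a' = c ** a \<and> b' = c ** b"
  then obtain c where "a' = c ** a" "b' = c ** b"
    by blast
  then show "L a' b' \<subseteq> L a b"
    by (auto simp: L_eq simp flip: vector_matrix_mul_assoc)
qed

text \<open>By maximality one inclusion between Lagrangian subspaces is already equality, so a
  single \<open>c\<close> suffices and its invertibility is not asked for.\<close>

lemma lagrangian_L_eq_iff:
  assumes "lagrangian (L a b)" "lagrangian (L a' b')"
  shows "L a b = L a' b' \<longleftrightarrow> (\<exists>c. a' = c ** a \<and> b' = c ** b)"
  using assms unfolding L_subset_iff[symmetric] lagrangian_def by blast

end

theorem proposition2:
  fixes smul :: "'k::{field,finite} \<Rightarrow> 'w::ab_group_add \<Rightarrow> 'w"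
    and B :: "'w \<Rightarrow> 'w \<Rightarrow> 'k"
    and p q :: "'w ^ 'm::finite"
  assumes "symplectic_space smul B"
    and "vector_space.dim smul (UNIV :: 'w set) = 2 * CARD('m)"
    and "symplectic_space.symplectic_basis smul B p q"
  shows "(\<forall>a b. symplectic_space.lagrangian smul B (L_space smul p q a b) \<longleftrightarrow>
              right_ideal_sum a b = UNIV \<and> a ** transpose b = b ** transpose a)
       \<and> (\<forall>U. symplectic_space.lagrangian smul B U \<longrightarrow> (\<exists>a b. U = L_space smul p q a b))
       \<and> (\<forall>a b a' b'. symplectic_space.lagrangian smul B (L_space smul p q a b) \<longrightarrow>
              symplectic_space.lagrangian smul B (L_space smul p q a' b') \<longrightarrow>
              (L_space smul p q a b = L_space smul p q a' b' \<longleftrightarrow> (\<exists>c. a' = c ** a \<and> b' = c ** b)))"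
proof -
  interpret finite_symplectic_basis smul B p q
    using assms(1,3) by (simp add: finite_symplectic_basis_def finite_symplectic_basis_axioms_def)
  show ?thesis
    by (intro conjI allI impI lagrangian_L_iff lagrangian_eq_L lagrangian_L_eq_iff)
qed

end
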